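(* Let $X$ and $Y$ be two random variables with interval supports and quantile and density functions $F^{-1}$, $f$ and $G^{-1}$, $g$, respectively. Assume that $p\mapsto\frac{f(F^{-1}(p))}{g(G^{-1}(p))}$ on $(0,1)$ has a finite number $n\ge1$ of modes, located at $0<p_1<\cdots<p_n<1$, such that the last one occurs from decreasing to increasing (so the ratio is increasing on $(p_n,1)$, decreasing on the interval immediately preceding $p_n$, and so on alternately, down to $(0,p_1)$). Then $X\le_{\mathrm{dmrl}}Y$ if, and only if, one of the following sets of conditions is satisfied: (a) $n=2m$ and $$\int_{p_{2i-1}}^1(1-q)\left(\frac{1}{g(G^{-1}(q))}-\frac{f(F^{-1}(p_{2i-1}))}{g(G^{-1}(p_{2i-1}))}\frac{1}{f(F^{-1}(q))}\right)dq\ge0,\quad\text{for } i=1,\dots,m;$$ (b) $n=2m+1$, $$\int_{p_{2i}}^1(1-q)\left(\frac{1}{g(G^{-1}(q))}-\frac{f(F^{-1}(p_{2i}))}{g(G^{-1}(p_{2i}))}\frac{1}{f(F^{-1}(q))}\right)dq\ge0,\quad\text{for } i=1,\dots,m,$$ and $$\lim_{p\to0^+}\left[\frac{f(F^{-1}(p))}{g(G^{-1}(p))}\bigl(F^{-1}(p)-E[X]\bigr)-\bigl(G^{-1}(p)-E[Y]\bigr)\right]\ge0.$$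
   Context: Standing assumptions: $X$ and $Y$ are non-negative, have finite expectation, distribution functions $F$ and $G$, density functions $f$ and $g$, and interval supports $(l_X,u_X)$ and $(l_Y,u_Y)$ (bounded or unbounded). The quantile function is $F^{-1}(p)=\inf\{x\in\mathbb R: F(x)\ge p\}$, $p\in(0,1)$, and similarly for $G^{-1}$; quantile functions are differentiable on $(0,1)$ with $\frac{d}{dp}F^{-1}(p)=1/f(F^{-1}(p))$ and $\frac{d}{dp}G^{-1}(p)=1/g(G^{-1}(p))$. "Increasing" and "decreasing" are used in the non-strict sense. A mode of a function means a relative extreme (maximum or minimum), i.e. a point at which the function changes from increasing to decreasing or from decreasing to increasing. Limits are taken in the extended reals. The dmrl order: with $\overline F=1-F$ and $\overline G=1-G$, $X\le_{\mathrm{dmrl}}Y$ means that $$\frac{\int_{G^{-1}(p)}^{u_Y}\overline G(x)\,dx}{\int_{F^{-1}(p)}^{u_X}\overline F(x)\,dx}=\frac{\int_p^1\frac{1-q}{g(G^{-1}(q))}\,dq}{\int_p^1\frac{1-q}{f(F^{-1}(q))}\,dq}$$ is increasing in $p\in(0,1)$. *)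

theory Defs
  imports "HOL-Probability.Probability"
begin

definition dist_fun :: "'a measure \<Rightarrow> ('a \<Rightarrow> real) \<Rightarrow> real \<Rightarrow> real" where
  "dist_fun M X = cdf (distr M borel X)"

definition quantile_fun :: "'a measure \<Rightarrow> ('a \<Rightarrow> real) \<Rightarrow> real \<Rightarrow> real" where
  "quantile_fun M X p = Inf {x. p \<le> dist_fun M X x}"

text \<open>
  The standing assumptions on a random variable \<open>X\<close> with density \<open>f\<close> and interval support
  \<open>(l, u)\<close>; the endpoints are extended reals since the interval may be unbounded. Having
  \<open>(l, u)\<close> as support means that \<open>X\<close> lies in it almost surely and that \<open>f\<close> is positive on it;
  the values of \<open>f\<close> at the endpoints and outside are not constrained further. Positivity
  is also what gives \<open>1 / f (F\<^sup>-\<^sup>1 p)\<close> its ordinary meaning, as \<open>1 / 0 = 0\<close> in HOL.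
\<close>

definition nonneg_rv_with_density ::
    "'a measure \<Rightarrow> ('a \<Rightarrow> real) \<Rightarrow> (real \<Rightarrow> real) \<Rightarrow> ereal \<Rightarrow> ereal \<Rightarrow> bool" where
  "nonneg_rv_with_density M X f l u \<longleftrightarrow>
     prob_space M \<and>
     (\<forall>x. 0 \<le> f x) \<and>
     distributed M lborel X (\<lambda>x. ennreal (f x)) \<and>
     (AE \<omega> in M. 0 \<le> X \<omega>) \<and>
     integrable M X \<and>
     l < u \<and>
     (AE \<omega> in M. X \<omega> \<in> einterval l u) \<and>
     (\<forall>x\<in>einterval l u. 0 < f x) \<and>
     (\<forall>p\<in>{0<..<1}.
        (quantile_fun M X has_real_derivative 1 / f (quantile_fun M X p)) (at p))"

text \<open>The integral of the survival function from the \<open>p\<close>-quantile to the right endpoint \<open>u\<close>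
  of the support.\<close>

definition survival_tail :: "'a measure \<Rightarrow> ('a \<Rightarrow> real) \<Rightarrow> ereal \<Rightarrow> real \<Rightarrow> real" where
  "survival_tail M X u p = (LBINT x=ereal (quantile_fun M X p)..u. 1 - dist_fun M X x)"

text \<open>\<open>X \<le>\<^sub>d\<^sub>m\<^sub>r\<^sub>l Y\<close>. As usual for stochastic orders, the two variables may live on different
  probability spaces.\<close>

definition dmrl_le ::
    "'a measure \<Rightarrow> ('a \<Rightarrow> real) \<Rightarrow> ereal \<Rightarrow> 'b measure \<Rightarrow> ('b \<Rightarrow> real) \<Rightarrow> ereal \<Rightarrow> bool" where
  "dmrl_le M X uX N Y uY \<longleftrightarrow>
     mono_on {0<..<1} (\<lambda>p. survival_tail N Y uY p / survival_tail M X uX p)"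

text \<open>
  \<open>r\<close> on \<open>(0, 1)\<close> has the \<open>n\<close> modes \<open>p 1 < \<dots> < p n\<close>, the last one from decreasing to
  increasing. With \<open>p\<close> extended by the endpoints \<open>0\<close> (index \<open>0\<close>) and \<open>1\<close> (index \<open>n + 1\<close>), \<open>r\<close> is
  monotone on each of the \<open>n + 1\<close> open pieces, alternately, and increasing on the last one.
  Monotonicity is non-strict, so that plateaus are admitted.
\<close>

definition has_modes :: "(real \<Rightarrow> real) \<Rightarrow> nat \<Rightarrow> (nat \<Rightarrow> real) \<Rightarrow> bool" where
  "has_modes r n p \<longleftrightarrow>
     strict_mono_on {1..n} p \<and> 0 < p 1 \<and> p n < 1 \<and>
     (let e = (\<lambda>i. if i = 0 then 0 else if i = n + 1 then 1 else p i) in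
      \<forall>i\<le>n. if even (n - i) then mono_on {e i<..<e (i + 1)} r
                             else antimono_on {e i<..<e (i + 1)} r)"

end

theory Submission
  imports Defs
begin

text \<open>
  Write \<open>A\<close> and \<open>B\<close> for the survival tails of \<open>X\<close> and \<open>Y\<close> as functions of \<open>p\<close>. Then
  \<open>A' = - (1 - p) / f (F\<^sup>-\<^sup>1 p)\<close> and \<open>B' = r A'\<close>, so \<open>B / A\<close> is increasing iff
  \<open>\<phi> = B - r A\<close> is nonnegative. On a piece where \<open>r\<close> increases \<open>\<phi>\<close> decreases, and conversely, and
  \<open>\<phi> \<ge> 0\<close> on the last piece since \<open>A\<close> and \<open>B\<close> vanish at \<open>1\<close>. Hence \<open>\<phi> \<ge> 0\<close> only has to be
  tested at the maxima of \<open>r\<close>, where \<open>\<phi>\<close> is the integral in the conditions, and, when \<open>r\<close>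
  starts out decreasing, at \<open>0+\<close>. There the expression in condition (b) differs from \<open>\<phi>\<close> by
  \<open>r U - V\<close> with \<open>U\<close>, \<open>V\<close> the expected positive parts of \<open>F\<^sup>-\<^sup>1 p - X\<close> and \<open>G\<^sup>-\<^sup>1 p - Y\<close>; as
  \<open>V' = r U'\<close> and \<open>r\<close> decreases, \<open>0 \<le> r U \<le> V \<rightarrow> 0\<close>.
\<close>

subsection \<open>Quotients of derivatives\<close>

text \<open>\<open>V - c * U\<close> has derivative \<open>(r - c) * w\<close>, which is nonnegative
  inside the interval. This stands in for integrating \<open>c * w <= r * w\<close>.\<close>

lemma ratio_lower_bound:
  fixes U V r w :: "real \<Rightarrow> real"
  assumes "s \<le> t"
    and U: "\<And>q. q \<in> {s..t} \<Longrightarrow> (U has_real_derivative w q) (at q)"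
    and V: "\<And>q. q \<in> {s..t} \<Longrightarrow> (V has_real_derivative r q * w q) (at q)"
    and w: "\<And>q. q \<in> {s..t} \<Longrightarrow> w q > 0"
    and c: "\<And>q. q \<in> {s<..<t} \<Longrightarrow> c \<le> r q"
  shows "c * (U t - U s) \<le> V t - V s"
proof -
  have "V s - c * U s \<le> V t - c * U t"
  proof (rule DERIV_nonneg_imp_increasing_open[OF \<open>s \<le> t\<close>])
    fix q assume q: "s < q" "q < t"
    have "((\<lambda>q. V q - c * U q) has_real_derivative (r q - c) * w q) (at q)"
      using q by (auto intro!: derivative_eq_intros U V simp: algebra_simps)
    moreover have "(r q - c) * w q \<ge> 0"
      using q w[of q] c[of q] by auto
    ultimately show "\<exists>y. ((\<lambda>q. V q - c * U q) has_real_derivative y) (at q) \<and> y \<ge> 0"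
      by blast
  next
    show "continuous_on {s..t} (\<lambda>q. V q - c * U q)"
      by (intro continuous_intros DERIV_continuous_on[OF has_field_derivative_at_within]) (auto intro: U V)
  qed
  then show ?thesis by (simp add: algebra_simps)
qed

lemma ratio_upper_bound:
  fixes U V r w :: "real \<Rightarrow> real"
  assumes "s \<le> t"
    and U: "\<And>q. q \<in> {s..t} \<Longrightarrow> (U has_real_derivative w q) (at q)"
    and V: "\<And>q. q \<in> {s..t} \<Longrightarrow> (V has_real_derivative r q * w q) (at q)"
    and w: "\<And>q. q \<in> {s..t} \<Longrightarrow> w q > 0"
    and c: "\<And>q. q \<in> {s<..<t} \<Longrightarrow> r q \<le> c"
  shows "V t - V s \<le> c * (U t - U s)"
proof -
  have "(- c) * (U t - U s) \<le> (- V t) - (- V s)"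
    by (rule ratio_lower_bound[where r = "\<lambda>q. - r q" and w = w])
      (use assms in \<open>auto intro!: derivative_eq_intros\<close>)
  then show ?thesis by (simp add: algebra_simps)
qed

text \<open>A quotient of derivatives has no jumps (it has the Darboux property), so its monotonicity
  on an open piece extends to the endpoints although \<open>has_modes\<close> says nothing about the values
  there.\<close>

lemma ratio_le_at_left_end:
  fixes U V r w :: "real \<Rightarrow> real"
  assumes "s < t"
    and U: "\<And>q. q \<in> {s..<t} \<Longrightarrow> (U has_real_derivative w q) (at q)"
    and V: "\<And>q. q \<in> {s..<t} \<Longrightarrow> (V has_real_derivative r q * w q) (at q)"
    and w: "\<And>q. q \<in> {s..<t} \<Longrightarrow> w q > 0"
    and c: "\<And>q. q \<in> {s<..<t} \<Longrightarrow> r q \<le> c"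
  shows "r s \<le> c"
proof (rule ccontr)
  assume "\<not> r s \<le> c"
  \<comment> \<open>If \<open>r s\<close> exceeded \<open>c\<close>, then \<open>V - c * U\<close>
    would strictly increase just to the right of \<open>s\<close>, against the upper bound for
    increments on \<open>{s..s + h}\<close>.\<close>
  then have pos: "0 < (r s - c) * w s"
    using w[of s] \<open>s < t\<close> by simp
  have "((\<lambda>q. V q - c * U q) has_real_derivative (r s - c) * w s) (at s)"
    using \<open>s < t\<close> by (auto intro!: derivative_eq_intros U V simp: algebra_simps)
  from DERIV_pos_inc_right[OF this pos]
  obtain d where d: "d > 0" "\<And>h. 0 < h \<Longrightarrow> h < d \<Longrightarrow> V s - c * U s < V (s + h) - c * U (s + h)"
    by auto
  define h where "h = min (d / 2) ((t - s) / 2)"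
  have h: "0 < h" "h < d" "s + h < t"
    using d(1) \<open>s < t\<close> by (auto simp: h_def min_def field_simps)
  have "V (s + h) - V s \<le> c * (U (s + h) - U s)"
    by (rule ratio_upper_bound[where r = r and w = w]) (use h U V w c in auto)
  with d(2)[OF h(1,2)] show False by (simp add: algebra_simps)
qed

text \<open>The reflection \<open>q -> - q\<close> turns a right end into a left end; negating the
  functions as well keeps the sign of their derivatives.\<close>

lemma ratio_le_at_right_end:
  fixes U V r w :: "real \<Rightarrow> real"
  assumes "s < t"
    and U: "\<And>q. q \<in> {s<..t} \<Longrightarrow> (U has_real_derivative w q) (at q)"
    and V: "\<And>q. q \<in> {s<..t} \<Longrightarrow> (V has_real_derivative r q * w q) (at q)"
    and w: "\<And>q. q \<in> {s<..t} \<Longrightarrow> w q > 0"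
    and c: "\<And>q. q \<in> {s<..<t} \<Longrightarrow> r q \<le> c"
  shows "r t \<le> c"
proof -
  have reflect: "((\<lambda>q. - g (- q)) has_real_derivative D) (at q)"
    if "(g has_real_derivative D) (at (- q))" for g :: "real \<Rightarrow> real" and D q
    using that by (auto intro!: derivative_eq_intros simp: DERIV_mirror)
  have "r (- (- t)) \<le> c"
    by (rule ratio_le_at_left_end[where s = "- t" and t = "- s" and w = "\<lambda>q. w (- q)"
          and r = "\<lambda>q. r (- q)" and U = "\<lambda>q. - U (- q)" and V = "\<lambda>q. - V (- q)"])
      (use assms in \<open>auto intro!: reflect\<close>)
  then show ?thesis by simp
qed

text \<open>The intersection with \<open>{0<..<1}\<close> leaves out the ends 0 and 1 of the
  outermost pieces, where no derivatives are given.\<close>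

lemma mono_on_derivative_ratio_closure:
  fixes U V r w :: "real \<Rightarrow> real"
  assumes U: "\<And>q. q \<in> {0<..<1} \<Longrightarrow> (U has_real_derivative w q) (at q)"
    and V: "\<And>q. q \<in> {0<..<1} \<Longrightarrow> (V has_real_derivative r q * w q) (at q)"
    and w: "\<And>q. q \<in> {0<..<1} \<Longrightarrow> w q > 0"
    and mono: "mono_on {x<..<y} r"
  shows "mono_on ({x..y} \<inter> {0<..<1}) r"
proof (rule mono_onI)
  fix s t assume s: "s \<in> {x..y} \<inter> {0<..<1}" and t: "t \<in> {x..y} \<inter> {0<..<1}" and "s \<le> t"
  show "r s \<le> r t"
  proof (cases "s = t")
    case False
    with \<open>s \<le> t\<close> have "s < t" by simp
    \<comment> \<open>The midpoint lies strictly inside the piece even when \<open>s\<close> and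
      \<open>t\<close> are its ends, so \<open>r q\<close> bounds \<open>r\<close> above on
      \<open>(s, q)\<close> and below on \<open>(q, t)\<close>.\<close>
    define q where "q = (s + t) / 2"
    have q: "s < q" "q < t" using \<open>s < t\<close> by (auto simp: q_def)
    have "r s \<le> r q"
      by (rule ratio_le_at_left_end[OF q(1), where U = U and V = V and w = w])
        (use q s t in \<open>auto intro!: U V w mono_onD[OF mono]\<close>)
    moreover have "- r t \<le> - r q"
      by (rule ratio_le_at_right_end[OF q(2), where U = U and V = "\<lambda>q. - V q" and w = w])
        (use q s t in \<open>auto intro!: derivative_eq_intros U V w mono_onD[OF mono]\<close>)
    ultimately show ?thesis by simp
  qed simp
qed

lemma antimono_on_derivative_ratio_closure:
  fixes U V r w :: "real \<Rightarrow> real"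
  assumes U: "\<And>q. q \<in> {0<..<1} \<Longrightarrow> (U has_real_derivative w q) (at q)"
    and V: "\<And>q. q \<in> {0<..<1} \<Longrightarrow> (V has_real_derivative r q * w q) (at q)"
    and w: "\<And>q. q \<in> {0<..<1} \<Longrightarrow> w q > 0"
    and anti: "antimono_on {x<..<y} r"
  shows "antimono_on ({x..y} \<inter> {0<..<1}) r"
proof -
  have "mono_on ({x..y} \<inter> {0<..<1}) (\<lambda>q. - r q)"
    by (rule mono_on_derivative_ratio_closure[where U = U and V = "\<lambda>q. - V q" and w = w])
      (use assms in \<open>auto intro!: derivative_eq_intros simp: monotone_on_def\<close>)
  then show ?thesis by (auto simp: monotone_on_def)
qed

subsection \<open>Monotonicity of a quotient of tails\<close>

lemma has_modes_location:
  assumes "n \<ge> 1" "has_modes r n p" "k \<in> {1..n}"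
  shows "p k \<in> {0<..<1}"
proof -
  have inc: "strict_mono_on {1..n} p" and ends: "0 < p 1" "p n < 1"
    using assms(2) by (auto simp: has_modes_def)
  have "p 1 \<le> p k" "p k \<le> p n"
    using assms strict_mono_on_leD[OF inc] by auto
  with ends show ?thesis by simp
qed

text \<open>This separates the calculus from the probability: \<open>A\<close> and \<open>B\<close>
  stand for the two survival tails as functions of the quantile level, \<open>w t\<close> for
  \<open>(1 - t) * (1 / f (Finv t))\<close>.\<close>

locale tail_pair =
  fixes w r A B :: "real \<Rightarrow> real"
  assumes weight_pos: "t \<in> {0<..<1} \<Longrightarrow> 0 < w t"
    and DERIV_A: "t \<in> {0<..<1} \<Longrightarrow> (A has_real_derivative - w t) (at t)"
    and DERIV_B: "t \<in> {0<..<1} \<Longrightarrow> (B has_real_derivative - (r t * w t)) (at t)"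
    and A_tendsto_0: "(A \<longlongrightarrow> 0) (at_left 1)"
    and B_tendsto_0: "(B \<longlongrightarrow> 0) (at_left 1)"
begin

text \<open>Up to a positive factor, \<open>gap\<close> is the derivative of \<open>B / A\<close>.\<close>

definition gap :: "real \<Rightarrow> real" where
  "gap t = B t - r t * A t"

lemma A_strict_decreasing:
  assumes "s \<in> {0<..<1}" "t \<in> {0<..<1}" "s < t"
  shows "A t < A s"
proof (rule DERIV_neg_imp_decreasing[OF \<open>s < t\<close>])
  fix q assume "s \<le> q" "q \<le> t"
  then have "q \<in> {0<..<1}" using assms by auto
  then show "\<exists>D. (A has_real_derivative D) (at q) \<and> D < 0"
    using DERIV_A[of q] weight_pos[of q] by (intro exI[of _ "- w q"]) simp
qed

lemma A_pos:
  assumes "t \<in> {0<..<1}"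
  shows "0 < A t"
proof -
  \<comment> \<open>The limit at 1 yields only \<open>0 <= A m\<close>; strict decrease from
    \<open>t\<close> to \<open>m\<close> makes the inequality strict.\<close>
  define m where "m = (t + 1) / 2"
  have m: "m \<in> {0<..<1}" "t < m" using assms by (auto simp: m_def)
  have "0 \<le> A m"
    by (rule tendsto_upperbound[OF A_tendsto_0])
      (use m A_strict_decreasing[OF m(1)] in
        \<open>auto simp: eventually_at_left_field less_imp_le intro!: exI[of _ m]\<close>)
  then show ?thesis using A_strict_decreasing[OF assms m] by simp
qed

lemma increments_lower:
  assumes "0 < s" "s \<le> t" "t < 1" "\<And>q. q \<in> {s<..<t} \<Longrightarrow> c \<le> r q"
  shows "c * (A s - A t) \<le> B s - B t"
proof -
  have "c * (- A t - - A s) \<le> - B t - - B s"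
    by (rule ratio_lower_bound[where r = r and w = w])
      (use assms in \<open>auto intro!: derivative_eq_intros DERIV_A DERIV_B weight_pos\<close>)
  then show ?thesis by (simp add: algebra_simps)
qed

lemma increments_upper:
  assumes "0 < s" "s \<le> t" "t < 1" "\<And>q. q \<in> {s<..<t} \<Longrightarrow> r q \<le> c"
  shows "B s - B t \<le> c * (A s - A t)"
proof -
  have "- B t - - B s \<le> c * (- A t - - A s)"
    by (rule ratio_upper_bound[where r = r and w = w])
      (use assms in \<open>auto intro!: derivative_eq_intros DERIV_A DERIV_B weight_pos\<close>)
  then show ?thesis by (simp add: algebra_simps)
qed

text \<open>\<open>gap s - gap t\<close> is the sum of
  \<open>(B s - B t) - r s * (A s - A t)\<close> and \<open>(r t - r s) * A t\<close>, both
  nonnegative. Increments replace the derivative of \<open>gap\<close>, as \<open>r\<close> need not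
  be differentiable.\<close>

lemma gap_antimono:
  assumes r: "mono_on {x<..<y} r"
  shows "antimono_on ({x..y} \<inter> {0<..<1}) gap"
proof (rule monotone_onI)
  fix s t assume s: "s \<in> {x..y} \<inter> {0<..<1}" and t: "t \<in> {x..y} \<inter> {0<..<1}" and "s \<le> t"
  have "mono_on ({x..y} \<inter> {0<..<1}) r"
    by (rule mono_on_derivative_ratio_closure[where U = "\<lambda>t. - A t" and V = "\<lambda>t. - B t" and w = w])
      (use r in \<open>auto intro!: derivative_eq_intros DERIV_A DERIV_B weight_pos\<close>)
  note r = mono_onD[OF this]
  have "r s * (A s - A t) \<le> B s - B t"
    by (rule increments_lower) (use s t \<open>s \<le> t\<close> in \<open>auto intro!: r\<close>)
  moreover have "r s * A t \<le> r t * A t"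
    using A_pos[of t] r[OF s t \<open>s \<le> t\<close>] t by (intro mult_right_mono) auto
  ultimately show "gap t \<le> gap s" by (simp add: gap_def algebra_simps)
qed

lemma gap_mono:
  assumes r: "antimono_on {x<..<y} r"
  shows "mono_on ({x..y} \<inter> {0<..<1}) gap"
proof (rule mono_onI)
  fix s t assume s: "s \<in> {x..y} \<inter> {0<..<1}" and t: "t \<in> {x..y} \<inter> {0<..<1}" and "s \<le> t"
  have "antimono_on ({x..y} \<inter> {0<..<1}) r"
    by (rule antimono_on_derivative_ratio_closure[where U = "\<lambda>t. - A t" and V = "\<lambda>t. - B t" and w = w])
      (use r in \<open>auto intro!: derivative_eq_intros DERIV_A DERIV_B weight_pos\<close>)
  note r = monotone_onD[OF this]
  have "B s - B t \<le> r s * (A s - A t)"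
    by (rule increments_upper) (use s t \<open>s \<le> t\<close> in \<open>auto intro!: r\<close>)
  moreover have "r t * A t \<le> r s * A t"
    using A_pos[of t] r[OF s t \<open>s \<le> t\<close>] t by (intro mult_right_mono) auto
  ultimately show "gap s \<le> gap t" by (simp add: gap_def algebra_simps)
qed

text \<open>Let \<open>q\<close> tend to 1 in \<open>r t * (A t - A q) <= B t - B q\<close>, which
  holds because \<open>r\<close> is at least \<open>r t\<close> from \<open>t\<close> on.\<close>

lemma gap_nonneg_last_piece:
  assumes r: "mono_on {x<..<1} r" and t: "t \<in> {x..<1}" "0 < t"
  shows "0 \<le> gap t"
proof -
  have "mono_on ({x..1} \<inter> {0<..<1}) r"
    by (rule mono_on_derivative_ratio_closure[where U = "\<lambda>t. - A t" and V = "\<lambda>t. - B t" and w = w])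
      (use r in \<open>auto intro!: derivative_eq_intros DERIV_A DERIV_B weight_pos\<close>)
  note r = mono_onD[OF this]
  have "r t * (A t - 0) \<le> B t - 0"
  proof (rule tendsto_le[OF trivial_limit_at_left_real])
    show "((\<lambda>q. B t - B q) \<longlongrightarrow> B t - 0) (at_left 1)"
      by (intro tendsto_intros B_tendsto_0)
    show "((\<lambda>q. r t * (A t - A q)) \<longlongrightarrow> r t * (A t - 0)) (at_left 1)"
      by (intro tendsto_intros A_tendsto_0)
    have "r t * (A t - A q) \<le> B t - B q" if "q \<in> {t<..<1}" for q
      by (rule increments_lower) (use t that in \<open>auto intro!: r\<close>)
    then show "\<forall>\<^sub>F q in at_left 1. r t * (A t - A q) \<le> B t - B q"
      using t by (auto simp: eventually_at_left_field intro!: exI[of _ t])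
  qed
  then show ?thesis by (simp add: gap_def)
qed

text \<open>\<open>B / A\<close> has derivative \<open>w t * gap t / (A t)\<^sup>2\<close>, whose
  sign is that of \<open>gap t\<close>.\<close>

lemma mono_quotient_iff_gap_nonneg:
  "mono_on {0<..<1} (\<lambda>t. B t / A t) \<longleftrightarrow> (\<forall>t\<in>{0<..<1}. 0 \<le> gap t)"
proof -
  have D: "((\<lambda>t. B t / A t) has_real_derivative w t * gap t / (A t)\<^sup>2) (at t)"
    if t: "t \<in> {0<..<1}" for t
    using A_pos[OF t]
    by (auto intro!: derivative_eq_intros DERIV_A DERIV_B t
        simp: gap_def power2_eq_square algebra_simps)
  show ?thesis
  proof
    assume mono: "mono_on {0<..<1} (\<lambda>t. B t / A t)"
    show "\<forall>t\<in>{0<..<1}. 0 \<le> gap t"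
    proof
      fix t :: real assume t: "t \<in> {0<..<1}"
      have "0 \<le> w t * gap t / (A t)\<^sup>2"
        by (rule mono_on_imp_deriv_nonneg[OF mono D[OF t]]) (use t in simp)
      then show "0 \<le> gap t"
        using A_pos[OF t] weight_pos[OF t] by (auto simp: zero_le_divide_iff zero_le_mult_iff)
    qed
  next
    assume nonneg: "\<forall>t\<in>{0<..<1}. 0 \<le> gap t"
    show "mono_on {0<..<1} (\<lambda>t. B t / A t)"
    proof (rule mono_onI)
      fix s t :: real assume st: "s \<in> {0<..<1}" "t \<in> {0<..<1}" "s \<le> t"
      show "B s / A s \<le> B t / A t"
      proof (rule DERIV_nonneg_imp_nondecreasing[OF \<open>s \<le> t\<close>])
        fix q assume "s \<le> q" "q \<le> t"
        then have q: "q \<in> {0<..<1}" using st by auto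
        then have "0 \<le> w q * gap q / (A q)\<^sup>2"
          using weight_pos[OF q] nonneg by simp
        with D[OF q] show "\<exists>D. ((\<lambda>t. B t / A t) has_real_derivative D) (at q) \<and> 0 \<le> D"
          by blast
      qed
    qed
  qed
qed

text \<open>Between two modes \<open>gap\<close> is smallest at the end where \<open>r\<close> is
  largest: the right end if \<open>r\<close> increases, the left end if it decreases. These ends are
  the \<open>p k\<close> with \<open>n - k\<close> odd. The last piece needs no test; the first,
  when \<open>r\<close> decreases there, has no mode at its left end and keeps its own
  condition.\<close>

lemma gap_nonneg_iff_at_modes:
  assumes n: "n \<ge> 1" and modes: "has_modes r n p"
  shows "(\<forall>t\<in>{0<..<1}. 0 \<le> gap t) \<longleftrightarrow>
    (\<forall>k\<in>{1..n}. odd (n - k) \<longrightarrow> 0 \<le> gap (p k)) \<and> (odd n \<longrightarrow> (\<forall>t\<in>{0<..p 1}. 0 \<le> gap t))"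
proof -
  define e where "e = (\<lambda>i. if i = 0 then 0 else if i = n + 1 then 1 else p i)"
  have piece: "\<And>i. i \<le> n \<Longrightarrow> if even (n - i) then mono_on {e i<..<e (i + 1)} r
                                 else antimono_on {e i<..<e (i + 1)} r"
    using modes unfolding has_modes_def Let_def e_def by blast
  note p_range = has_modes_location[OF n modes]
  show ?thesis
  proof (intro iffI conjI ballI impI)
    fix t assume *: "(\<forall>k\<in>{1..n}. odd (n - k) \<longrightarrow> 0 \<le> gap (p k)) \<and>
      (odd n \<longrightarrow> (\<forall>t\<in>{0<..p 1}. 0 \<le> gap t))" and t: "t \<in> {0<..<1::real}"
    from * have modes_nonneg: "0 \<le> gap (p k)" if "k \<in> {1..n}" "odd (n - k)" for k
      using that by blast
    \<comment> \<open>The index of the piece containing \<open>t\<close>, so that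
      \<open>e i <= t < e (i + 1)\<close>.\<close>
    define i where "i = (GREATEST i. i \<le> n \<and> e i \<le> t)"
    have i: "i \<le> n \<and> e i \<le> t"
      unfolding i_def by (rule GreatestI_nat[of _ 0 n]) (use t in \<open>auto simp: e_def\<close>)
    have i_max: "j \<le> i" if "j \<le> n" "e j \<le> t" for j
      unfolding i_def by (rule Greatest_le_nat[of _ _ n]) (use that in auto)
    have upper: "t < e (i + 1)"
    proof (cases "i = n")
      case False
      with i i_max[of "i + 1"] show ?thesis by force
    qed (use t in \<open>simp add: e_def\<close>)
    consider "i = n" | "i < n" "even (n - i)" | "i < n" "odd (n - i)" "i > 0" | "i = 0" "odd n"
      using i by (cases "i = n"; cases "i = 0"; cases "even (n - i)") auto
    then show "0 \<le> gap t"
    proof cases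
      case 1
      show ?thesis
        by (rule gap_nonneg_last_piece[of "e n"]) (use piece[of n] i t 1 in \<open>auto simp: e_def\<close>)
    next
      case 2
      have "gap (e (i + 1)) \<le> gap t"
        by (rule monotone_onD[OF gap_antimono[of "e i" "e (i + 1)"]])
          (use 2 piece[of i] i t upper p_range[of "i + 1"] in \<open>auto simp: e_def\<close>)
      moreover have "0 \<le> gap (p (i + 1))"
        by (rule modes_nonneg) (use 2 in auto)
      ultimately show ?thesis using 2 by (simp add: e_def)
    next
      case 3
      have "gap (e i) \<le> gap t"
        by (rule mono_onD[OF gap_mono[of "e i" "e (i + 1)"]])
          (use 3 piece[of i] i t upper p_range[of i] in \<open>auto simp: e_def\<close>)
      moreover have "0 \<le> gap (p i)"
        by (rule modes_nonneg) (use 3 in auto)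
      ultimately show ?thesis using 3 by (simp add: e_def)
    next
      case 4
      then have "t \<in> {0<..p 1}" using t upper n by (simp add: e_def)
      with * 4 show ?thesis by blast
    qed
  next
    fix k assume "\<forall>t\<in>{0<..<1}. 0 \<le> gap t" "k \<in> {1..n}"
    then show "0 \<le> gap (p k)" using p_range by blast
  next
    fix t assume "\<forall>t\<in>{0<..<1}. 0 \<le> gap t" "t \<in> {0<..p 1}"
    then show "0 \<le> gap t" using p_range[of 1] n by auto
  qed
qed

text \<open>\<open>gap\<close> increases on \<open>{0<..b}\<close>, so it is nonnegative there iff
  its limit at 0 is. If it is nonnegative, the correction \<open>r * U - V\<close> vanishes in the
  limit, as it lies between \<open>- V\<close> and 0; for the converse its sign suffices. The limit
  is taken in \<open>ereal\<close> because \<open>gap\<close> may tend to minus infinity.\<close>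

lemma gap_nonneg_near_0_iff:
  fixes U V :: "real \<Rightarrow> real"
  assumes r: "antimono_on {0<..<b} r" "\<And>t. t \<in> {0<..<1} \<Longrightarrow> 0 \<le> r t" and b: "b \<in> {0<..<1}"
    and v: "\<And>t. t \<in> {0<..<1} \<Longrightarrow> 0 < v t"
    and U: "\<And>t. t \<in> {0<..<1} \<Longrightarrow> (U has_real_derivative v t) (at t)"
      "\<And>t. t \<in> {0<..<1} \<Longrightarrow> 0 \<le> U t" "(U \<longlongrightarrow> 0) (at_right 0)"
    and V: "\<And>t. t \<in> {0<..<1} \<Longrightarrow> (V has_real_derivative r t * v t) (at t)"
      "(V \<longlongrightarrow> 0) (at_right 0)"
  shows "(\<forall>t\<in>{0<..b}. 0 \<le> gap t) \<longleftrightarrow>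
    (\<exists>L::ereal. ((\<lambda>t. ereal (gap t + (r t * U t - V t))) \<longlongrightarrow> L) (at_right 0) \<and> L \<ge> 0)"
proof -
  have "antimono_on ({0..b} \<inter> {0<..<1}) r"
    by (rule antimono_on_derivative_ratio_closure[where U = U and V = V and w = v])
      (use r U V v in auto)
  note r' = monotone_onD[OF this]
  have "mono_on ({0..b} \<inter> {0<..<1}) gap"
    by (rule gap_mono) fact
  note gap = mono_onD[OF this]
  \<comment> \<open>As \<open>r\<close> decreases, \<open>r q >= r t\<close> for
    \<open>q < t\<close>; this bounds the increments of \<open>V\<close> over \<open>{q..t}\<close>
    from below, and \<open>q\<close> is sent to 0.\<close>
  have rU_le_V: "r t * U t \<le> V t" if t: "t \<in> {0<..b}" for t
  proof -
    have "r t * (U t - 0) \<le> V t - 0"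
    proof (rule tendsto_le[OF trivial_limit_at_right_real])
      show "((\<lambda>q. V t - V q) \<longlongrightarrow> V t - 0) (at_right 0)"
        by (intro tendsto_intros V)
      show "((\<lambda>q. r t * (U t - U q)) \<longlongrightarrow> r t * (U t - 0)) (at_right 0)"
        by (intro tendsto_intros U)
      have "r t * (U t - U q) \<le> V t - V q" if "q \<in> {0<..<t}" for q
        by (rule ratio_lower_bound[where r = r and w = v])
          (use t b that in \<open>auto intro!: r' U V v\<close>)
      then show "\<forall>\<^sub>F q in at_right 0. r t * (U t - U q) \<le> V t - V q"
        using t by (auto simp: eventually_at_right_field intro!: exI[of _ t])
    qed
    then show ?thesis by simp
  qed
  show ?thesis
  proof
    assume nonneg: "\<forall>t\<in>{0<..b}. 0 \<le> gap t"
    \<comment> \<open>An increasing function that is bounded below tends to its infimum at the left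
      end, so in this direction the limit is finite.\<close>
    define l where "l = Inf (gap ` {0<..b})"
    have bdd: "bdd_below (gap ` {0<..b})" using nonneg by (auto intro!: bdd_belowI[of _ 0])
    have ne: "gap ` {0<..b} \<noteq> {}" using b by auto
    have "(gap \<longlongrightarrow> l) (at_right 0)"
    proof (rule order_tendstoI)
      fix a assume "a < l"
      moreover have "l \<le> gap t" if "t \<in> {0<..b}" for t
        unfolding l_def using bdd that by (intro cInf_lower) auto
      ultimately show "\<forall>\<^sub>F t in at_right 0. a < gap t"
        using b by (force simp: eventually_at_right_field intro!: exI[of _ b])
    next
      fix a assume "l < a"
      then obtain s where s: "s \<in> {0<..b}" "gap s < a"
        unfolding l_def using cInf_lessD[OF ne] by blast
      have "gap t < a" if "t \<in> {0<..<s}" for t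
        using gap[of t s] s b that by auto
      then show "\<forall>\<^sub>F t in at_right 0. gap t < a"
        using s by (auto simp: eventually_at_right_field intro!: exI[of _ s])
    qed
    moreover have "((\<lambda>t. r t * U t - V t) \<longlongrightarrow> 0) (at_right 0)"
    proof (rule Lim_null_comparison[OF _ V(2)])
      have "norm (r t * U t - V t) \<le> V t" if "t \<in> {0<..<b}" for t
        using rU_le_V[of t] r(2)[of t] U(2)[of t] b that by auto
      then show "\<forall>\<^sub>F t in at_right 0. norm (r t * U t - V t) \<le> V t"
        using b by (auto simp: eventually_at_right_field intro!: exI[of _ b])
    qed
    ultimately have "((\<lambda>t. gap t + (r t * U t - V t)) \<longlongrightarrow> l + 0) (at_right 0)"
      by (rule tendsto_add)
    then have "((\<lambda>t. ereal (gap t + (r t * U t - V t))) \<longlongrightarrow> ereal l) (at_right 0)"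
      by simp
    moreover have "0 \<le> l"
      unfolding l_def using nonneg ne by (intro cInf_greatest) auto
    ultimately show "\<exists>L::ereal. ((\<lambda>t. ereal (gap t + (r t * U t - V t))) \<longlongrightarrow> L) (at_right 0) \<and> L \<ge> 0"
      by (intro exI[of _ "ereal l"]) simp
  next
    assume "\<exists>L::ereal. ((\<lambda>t. ereal (gap t + (r t * U t - V t))) \<longlongrightarrow> L) (at_right 0) \<and> L \<ge> 0"
    then obtain L :: ereal
      where L: "((\<lambda>t. ereal (gap t + (r t * U t - V t))) \<longlongrightarrow> L) (at_right 0)" "L \<ge> 0"
      by blast
    show "\<forall>t\<in>{0<..b}. 0 \<le> gap t"
    proof
      fix s assume s: "s \<in> {0<..b}"
      \<comment> \<open>The correction is at most 0 and \<open>gap\<close> is increasing, so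
        \<open>gap s\<close> bounds every value to the left of \<open>s\<close>, and hence
        \<open>L\<close>, finite or not.\<close>
      have "gap t + (r t * U t - V t) \<le> gap s" if "t \<in> {0<..<s}" for t
        using gap[of t s] rU_le_V[of t] s b that by auto
      then have "L \<le> ereal (gap s)"
        using s by (intro tendsto_upperbound[OF L(1)])
          (auto simp: eventually_at_right_field intro!: exI[of _ s])
      with L(2) show "0 \<le> gap s" by (metis ereal_less_eq(5) order_trans)
    qed
  qed
qed

end

subsection \<open>Survival tails as functions of the quantile level\<close>

locale rv_with_density =
  fixes M :: "'a measure" and X :: "'a \<Rightarrow> real" and f :: "real \<Rightarrow> real" and l u :: ereal
  assumes rv: "nonneg_rv_with_density M X f l u"
begin

abbreviation "F \<equiv> dist_fun M X"
abbreviation "Q \<equiv> quantile_fun M X"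

sublocale prob_space M
  using rv by (simp add: nonneg_rv_with_density_def)

lemma integrable_X [simp]: "integrable M X"
  and AE_nonneg: "AE \<omega> in M. 0 \<le> X \<omega>"
  and AE_support: "AE \<omega> in M. X \<omega> \<in> einterval l u"
  and density_pos: "x \<in> einterval l u \<Longrightarrow> 0 < f x"
  and distributed_X: "distributed M lborel X (\<lambda>x. ennreal (f x))"
  and density_nonneg: "0 \<le> f x"
  and DERIV_Q: "p \<in> {0<..<1} \<Longrightarrow> (Q has_real_derivative 1 / f (Q p)) (at p)"
  using rv by (auto simp: nonneg_rv_with_density_def)

lemma measurable_X [measurable]: "X \<in> borel_measurable M"
  using integrable_X by blast

lemma measurable_density [measurable]: "f \<in> borel_measurable borel"
proof -
  have "(\<lambda>x. enn2real (ennreal (f x))) \<in> borel_measurable borel"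
    using distributed_X by (auto simp: distributed_def)
  then show ?thesis by (simp add: density_nonneg)
qed

sublocale X: real_distribution "distr M borel X"
  by (rule real_distribution_distr) simp

lemma F_eq: "F x = \<P>(\<omega> in M. X \<omega> \<le> x)"
  by (simp add: dist_fun_def cdf_def measure_distr vimage_def Int_def conj_commute)

lemma survival_eq: "1 - F x = \<P>(\<omega> in M. x < X \<omega>)"
proof -
  have "\<P>(\<omega> in M. \<not> X \<omega> \<le> x) = 1 - F x"
    unfolding F_eq by (rule prob_neg) simp
  then show ?thesis by (simp add: not_le)
qed

lemma F_mono: "x \<le> y \<Longrightarrow> F x \<le> F y"
  unfolding dist_fun_def by (rule X.cdf_nondecreasing)

lemma F_eq_1:
  assumes "u \<le> ereal x"
  shows "F x = 1"
proof -
  have "AE \<omega> in M. X \<omega> \<le> x"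
    using AE_support
  proof eventually_elim
    fix \<omega> assume "X \<omega> \<in> einterval l u"
    then have "ereal (X \<omega>) < ereal x" 
      using assms unfolding einterval_iff by (blast intro: less_le_trans)
    then show "X \<omega> \<le> x" by simp
  qed
  then show ?thesis unfolding F_eq by (subst prob_Collect_eq_1) auto
qed

lemma F_eq_0:
  assumes "ereal x \<le> l"
  shows "F x = 0"
proof -
  have "AE \<omega> in M. \<not> X \<omega> \<le> x"
    using AE_support
  proof eventually_elim
    fix \<omega> assume "X \<omega> \<in> einterval l u"
    then have "ereal x < ereal (X \<omega>)" 
      using assms unfolding einterval_iff by (blast intro: le_less_trans)
    then show "\<not> X \<omega> \<le> x" by simp
  qed
  then show ?thesis unfolding F_eq by (subst prob_Collect_eq_0) auto
qed

lemma F_eq_0': "x < 0 \<Longrightarrow> F x = 0"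
  unfolding F_eq using AE_nonneg by (subst prob_Collect_eq_0) (auto elim!: eventually_mono)

lemma isCont_F: "isCont F x"
proof -
  have "measure (distr M borel X) {x} = 0"
  proof -
    have "emeasure (distr M lborel X) {x} = 0"
      unfolding distributed_distr_eq_density[OF distributed_X]
      by (subst emeasure_density) (auto intro!: nn_integral_null_set)
    then have "emeasure (distr M borel X) {x} = 0"
      by (simp add: emeasure_distr)
    then show ?thesis by (simp add: measure_def)
  qed
  then show ?thesis unfolding dist_fun_def by (simp add: X.isCont_cdf)
qed

text \<open>The set in the definition of the quantile is closed by continuity of \<open>F\<close>,
  and the limits of \<open>F\<close> at both infinities make it nonempty and bounded below. So its
  \<open>Inf\<close> is attained.\<close>

lemma Q_le_iff:
  assumes "p \<in> {0<..<1}"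
  shows "Q p \<le> x \<longleftrightarrow> p \<le> F x"
proof -
  let ?S = "{x. p \<le> F x}"
  have cont: "continuous_on UNIV F"
    by (simp add: continuous_on_eq_continuous_at isCont_F)
  have "eventually (\<lambda>x. F x < p) at_bot"
    using X.cdf_lim_at_bot assms by (auto simp: order_tendsto_iff dist_fun_def)
  then obtain a where a: "\<And>x. x \<le> a \<Longrightarrow> F x < p"
    by (auto simp: eventually_at_bot_linorder)
  have bdd: "bdd_below ?S"
    using a by (intro bdd_belowI[of _ a]) (meson linear mem_Collect_eq not_less)
  have "eventually (\<lambda>x. p < F x) at_top"
    using X.cdf_lim_at_top_prob assms by (auto simp: order_tendsto_iff dist_fun_def)
  then have ne: "?S \<noteq> {}"
    by (metis (mono_tags, lifting) empty_Collect_eq eventually_at_top_linorder less_imp_le order_refl)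
  have "closed ?S"
    using cont by (intro closed_Collect_le) auto
  from closed_contains_Inf[OF ne bdd this] have "p \<le> F (Q p)"
    by (simp add: quantile_fun_def)
  then show ?thesis
    using F_mono[of "Q p" x] cInf_lower[of x ?S] bdd by (auto simp: quantile_fun_def)
qed

text \<open>Points to the left of \<open>Q p\<close> have \<open>F\<close> below \<open>p\<close>;
  continuity of \<open>F\<close> carries the bound over to \<open>Q p\<close>.\<close>

lemma F_Q:
  assumes "p \<in> {0<..<1}"
  shows "F (Q p) = p"
proof (rule antisym)
  show "p \<le> F (Q p)" using Q_le_iff[OF assms, of "Q p"] by simp
  have "(F \<longlongrightarrow> F (Q p)) (at_left (Q p))"
    using isCont_F[of "Q p"] by (simp add: isCont_def filterlim_at_split)
  moreover have "eventually (\<lambda>x. F x \<le> p) (at_left (Q p))"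
    using Q_le_iff[OF assms] by (auto simp: eventually_at_filter not_le intro!: always_eventually)
      (meson linorder_le_cases not_less)
  ultimately show "F (Q p) \<le> p"
    by (rule tendsto_upperbound) simp
qed

text \<open>\<open>F\<close> is 0 up to \<open>l\<close> and 1 from \<open>u\<close> on, whereas
  \<open>F (Q p) = p\<close> lies strictly between.\<close>

lemma Q_support:
  assumes "p \<in> {0<..<1}"
  shows "Q p \<in> einterval l u"
  using F_eq_0[of "Q p"] F_eq_1[of "Q p"] F_Q[OF assms] assms
  by (force simp: einterval_def not_le[symmetric])

lemma Q_nonneg: "p \<in> {0<..<1} \<Longrightarrow> 0 \<le> Q p"
  using F_eq_0'[of "Q p"] F_Q[of p] by force

lemma Q_mono: "p \<in> {0<..<1} \<Longrightarrow> q \<in> {0<..<1} \<Longrightarrow> p \<le> q \<Longrightarrow> Q p \<le> Q q"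
  by (simp add: Q_le_iff F_Q)

lemma density_Q_pos: "p \<in> {0<..<1} \<Longrightarrow> 0 < f (Q p)"
  by (intro density_pos Q_support)

section \<open>The expected excess over a threshold\<close>

text \<open>The stop-loss transform of \<open>X\<close>: the form of the survival tail in which
  derivatives and limits are handled under the expectation.\<close>

definition excess :: "real \<Rightarrow> real" where
  "excess c = (LINT \<omega>|M. max 0 (X \<omega> - c))"

lemma integrable_excess [simp]: "integrable M (\<lambda>\<omega>. max 0 (X \<omega> - c))"
  by (intro integrable_max) auto

text \<open>Layer-cake formula: \<open>1 - F x\<close> is the probability of \<open>x < X\<close>,
  and Tonelli exchanges the two integrals; the inner one is then the length of the interval from
  \<open>Q p\<close> to \<open>X \<omega>\<close>.\<close>

lemma survival_tail_eq:
  assumes p: "p \<in> {0<..<1}"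
  shows "survival_tail M X u p = excess (Q p)"
proof -
  let ?c = "Q p"
  interpret P: pair_sigma_finite lborel M ..
  have [measurable]: "F \<in> borel_measurable borel"
    by (intro borel_measurable_mono monoI F_mono)
  have "ereal ?c \<le> u"
    using Q_support[OF p] by (simp add: einterval_def less_imp_le)
  then have "survival_tail M X u p = (LINT x|lborel. indicator (einterval ?c u) x * (1 - F x))"
    by (simp add: survival_tail_def interval_lebesgue_integral_def set_lebesgue_integral_def)
  also have "\<dots> = (LINT x|lborel. indicator {?c<..} x * (1 - F x))"
    using F_eq_1 by (intro Bochner_Integration.integral_cong) (auto simp: indicator_def einterval_def not_less)
  also have "\<dots> = enn2real (\<integral>\<^sup>+x. ennreal (indicator {?c<..} x * (1 - F x)) \<partial>lborel)"
    by (intro integral_eq_nn_integral) (auto simp: F_eq)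
  also have "(\<integral>\<^sup>+x. ennreal (indicator {?c<..} x * (1 - F x)) \<partial>lborel)
      = (\<integral>\<^sup>+x. (\<integral>\<^sup>+\<omega>. indicator {?c<..<X \<omega>} x \<partial>M) \<partial>lborel)"
  proof (intro nn_integral_cong)
    fix x :: real
    have "(\<integral>\<^sup>+\<omega>. indicator {?c<..<X \<omega>} x \<partial>M)
        = (\<integral>\<^sup>+\<omega>. indicator {?c<..} x * indicator {\<omega>\<in>space M. x < X \<omega>} \<omega> \<partial>M)"
      by (intro nn_integral_cong) (auto simp: indicator_def)
    also have "\<dots> = indicator {?c<..} x * emeasure M {\<omega>\<in>space M. x < X \<omega>}"
      by (subst nn_integral_cmult) auto
    also have "\<dots> = ennreal (indicator {?c<..} x * (1 - F x))"
      by (auto simp: survival_eq emeasure_eq_measure indicator_def)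
    finally show "ennreal (indicator {?c<..} x * (1 - F x)) = (\<integral>\<^sup>+\<omega>. indicator {?c<..<X \<omega>} x \<partial>M)" ..
  qed
  also have "\<dots> = (\<integral>\<^sup>+\<omega>. (\<integral>\<^sup>+x. indicator {?c<..<X \<omega>} x \<partial>lborel) \<partial>M)"
    by (rule P.Fubini'[symmetric]) (auto simp: greaterThanLessThan_def greaterThan_def lessThan_def)
  also have "\<dots> = (\<integral>\<^sup>+\<omega>. ennreal (max 0 (X \<omega> - ?c)) \<partial>M)"
  proof (intro nn_integral_cong)
    fix \<omega>
    show "(\<integral>\<^sup>+x. indicator {?c<..<X \<omega>} x \<partial>lborel) = ennreal (max 0 (X \<omega> - ?c))"
      by (cases "?c \<le> X \<omega>") (auto simp: max_def)
  qed
  also have "enn2real \<dots> = excess ?c"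
    unfolding excess_def by (rule integral_eq_nn_integral[symmetric]) auto
  finally show ?thesis .
qed

text \<open>Pointwise, the difference of the two positive parts lies between \<open>d - c\<close>
  times the indicator of \<open>d < X\<close> and \<open>d - c\<close> times that of
  \<open>c < X\<close>.\<close>

lemma excess_diff_bounds:
  assumes "c \<le> d"
  shows "excess c - excess d \<le> (d - c) * (1 - F c)"
    and "(d - c) * (1 - F d) \<le> excess c - excess d"
proof -
  have 1: "excess c - excess d = (LINT \<omega>|M. max 0 (X \<omega> - c) - max 0 (X \<omega> - d))"
    by (simp add: excess_def)
  have 2: "(d - c) * (1 - F e) = (LINT \<omega>|M. (d - c) * indicator {\<omega>\<in>space M. e < X \<omega>} \<omega>)" for e
    by (simp add: survival_eq)
  have int: "integrable M (\<lambda>\<omega>. (d - c) * indicator {\<omega>\<in>space M. e < X \<omega>} \<omega>)" for e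
    by (intro integrable_mult_right integrable_real_indicator) (auto simp: emeasure_eq_measure)
  show "excess c - excess d \<le> (d - c) * (1 - F c)"
    unfolding 1 2 using assms by (intro integral_mono int) (auto simp: indicator_def)
  show "(d - c) * (1 - F d) \<le> excess c - excess d"
    unfolding 1 2 using assms by (intro integral_mono int) (auto simp: indicator_def)
qed

text \<open>The difference quotient lies between \<open>F c - 1\<close> and \<open>F d - 1\<close>,
  and \<open>F\<close> is continuous.\<close>

lemma DERIV_excess: "(excess has_real_derivative F c - 1) (at c)"
proof -
  have "\<bar>(excess d - excess c) / (d - c) - (F c - 1)\<bar> \<le> \<bar>F d - F c\<bar>" if "d \<noteq> c" for d
  proof (cases "c < d")
    case True
    then have "(excess d - excess c) / (d - c) \<ge> F c - 1" "(excess d - excess c) / (d - c) \<le> F d - 1"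
      using excess_diff_bounds[of c d] by (auto simp: field_simps)
    then show ?thesis by simp
  next
    case False
    with that have "d < c" by simp
    then have "(excess d - excess c) / (d - c) \<le> F c - 1" "(excess d - excess c) / (d - c) \<ge> F d - 1"
      using excess_diff_bounds[of d c] by (auto simp: field_simps)
    then show ?thesis by simp
  qed
  then have bound: "\<forall>\<^sub>F d in at c. norm ((excess d - excess c) / (d - c) - (F c - 1)) \<le> \<bar>F d - F c\<bar>"
    unfolding eventually_at_filter by (intro always_eventually) simp
  have "((\<lambda>d. \<bar>F d - F c\<bar>) \<longlongrightarrow> 0) (at c)"
    using isCont_F[of c] unfolding isCont_def by (intro tendsto_rabs_zero) (simp add: LIM_zero_iff)
  from Lim_null_comparison[OF bound this]
  have "((\<lambda>d. (excess d - excess c) / (d - c) - (F c - 1)) \<longlongrightarrow> 0) (at c)" .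
  then show ?thesis
    by (simp add: has_field_derivative_iff LIM_zero_iff)
qed

lemma DERIV_excess_Q:
  assumes "p \<in> {0<..<1}"
  shows "((\<lambda>p. excess (Q p)) has_real_derivative - ((1 - p) * (1 / f (Q p)))) (at p)"
  using DERIV_chain2[OF DERIV_excess DERIV_Q[OF assms]]
  by (simp add: F_Q[OF assms] minus_divide_left)

lemma DERIV_survival_tail:
  assumes "p \<in> {0<..<1}"
  shows "(survival_tail M X u has_real_derivative - ((1 - p) * (1 / f (Q p)))) (at p)"
  by (rule has_field_derivative_transform_within_open[OF DERIV_excess_Q[OF assms], where S = "{0<..<1}"])
    (use assms in \<open>auto simp: survival_tail_eq\<close>)

section \<open>The survival tail near level 1\<close>

text \<open>The event of exceeding all \<open>Q (s k)\<close> has probability at most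
  \<open>1 - s k\<close> for every \<open>k\<close>, and \<open>s k\<close> tends to 1.\<close>

lemma AE_le_some_quantile: "AE \<omega> in M. \<exists>p\<in>{0<..<1}. X \<omega> \<le> Q p"
proof -
  \<comment> \<open>The shift by 2 keeps \<open>s 0 = 1 / 2\<close> inside the open unit
    interval.\<close>
  define s where "s k = 1 - 1 / real (k + 2)" for k
  have s: "s k \<in> {0<..<1}" for k by (auto simp: s_def field_simps)
  have "\<P>(\<omega> in M. \<forall>k. Q (s k) < X \<omega>) \<le> 1 - s k" for k
  proof -
    have "\<P>(\<omega> in M. \<forall>k. Q (s k) < X \<omega>) \<le> \<P>(\<omega> in M. Q (s k) < X \<omega>)"
      by (intro finite_measure_mono) auto
    also have "\<dots> = 1 - s k"
      using survival_eq[of "Q (s k)"] F_Q[OF s[of k]] by simp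
    finally show ?thesis .
  qed
  moreover have "(\<lambda>k. 1 - s k) \<longlonglongrightarrow> 0"
    unfolding s_def using LIMSEQ_ignore_initial_segment[OF lim_1_over_n, of 2] by simp
  ultimately have "\<P>(\<omega> in M. \<forall>k. Q (s k) < X \<omega>) \<le> 0"
    by (intro LIMSEQ_le_const) auto
  then have "\<P>(\<omega> in M. \<forall>k. Q (s k) < X \<omega>) = 0"
    by (simp add: measure_le_0_iff)
  then have "AE \<omega> in M. \<not> (\<forall>k. Q (s k) < X \<omega>)"
    by (subst (asm) prob_Collect_eq_0) auto
  then show ?thesis
    by eventually_elim (use s in \<open>auto simp: not_less\<close>)
qed

text \<open>Dominated convergence with bound \<open>\<bar>X \<omega>\<bar>\<close>, valid as
  quantiles are nonnegative. Almost surely the integrand is eventually 0, since \<open>X\<close>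
  lies below some quantile of level less than 1.\<close>

lemma excess_Q_tendsto_0: "((\<lambda>p. excess (Q p)) \<longlongrightarrow> 0) (at_left 1)"
proof (rule tendsto_at_left_sequentially[where b = 0])
  fix S :: "nat \<Rightarrow> real" assume S: "\<And>k. S k < 1" "\<And>k. 0 < S k" "S \<longlonglongrightarrow> 1"
  have "(\<lambda>k. excess (Q (S k))) \<longlonglongrightarrow> (LINT \<omega>|M. 0)"
    unfolding excess_def
  proof (rule integral_dominated_convergence[where w = "\<lambda>\<omega>. \<bar>X \<omega>\<bar>"])
    show "AE \<omega> in M. norm (max 0 (X \<omega> - Q (S k))) \<le> \<bar>X \<omega>\<bar>" for k
      using Q_nonneg[of "S k"] S by auto
    show "AE \<omega> in M. (\<lambda>k. max 0 (X \<omega> - Q (S k))) \<longlonglongrightarrow> 0"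
      using AE_le_some_quantile
    proof eventually_elim
      fix \<omega> assume "\<exists>p\<in>{0<..<1}. X \<omega> \<le> Q p"
      then obtain p where p: "p \<in> {0<..<1}" "X \<omega> \<le> Q p" by blast
      have "eventually (\<lambda>k. p < S k) sequentially"
        using S(3) p(1) by (auto simp: order_tendsto_iff)
      then have "eventually (\<lambda>k. max 0 (X \<omega> - Q (S k)) = 0) sequentially"
      proof eventually_elim
        fix k assume "p < S k"
        then have "Q p \<le> Q (S k)" using p S by (intro Q_mono) auto
        with p(2) show "max 0 (X \<omega> - Q (S k)) = 0" by simp
      qed
      then show "(\<lambda>k. max 0 (X \<omega> - Q (S k))) \<longlonglongrightarrow> 0" by (rule tendsto_eventually)
    qed
  qed auto
  then show "(\<lambda>k. excess (Q (S k))) \<longlonglongrightarrow> 0" by simp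
qed simp

lemma survival_tail_tendsto_0: "(survival_tail M X u \<longlongrightarrow> 0) (at_left 1)"
  using excess_Q_tendsto_0
  by (rule Lim_transform_eventually)
    (auto simp: eventually_at_left_field survival_tail_eq intro!: exI[of _ 0])

section \<open>The expected shortfall near level 0\<close>

text \<open>\<open>shortfall p\<close> is the expectation of the positive part of \<open>Q p - X\<close>.\<close>

definition shortfall :: "real \<Rightarrow> real" where
  "shortfall p = survival_tail M X u p + Q p - (LINT \<omega>|M. X \<omega>)"

lemma DERIV_shortfall:
  assumes "p \<in> {0<..<1}"
  shows "(shortfall has_real_derivative p * (1 / f (Q p))) (at p)"
  unfolding shortfall_def
  by (auto intro!: derivative_eq_intros DERIV_survival_tail DERIV_Q assms simp: diff_divide_distrib)

text \<open>Since \<open>max 0 (X - c) + c - X = max 0 (c - X)\<close>, the shortfall is a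
  nonnegative expectation. As \<open>X\<close> is nonnegative, the integrand is at most
  \<open>Q p\<close> on an event of probability \<open>p\<close> and 0 elsewhere.\<close>

lemma shortfall_bounds:
  assumes p: "p \<in> {0<..<1}"
  shows "0 \<le> shortfall p" and "shortfall p \<le> p * Q p"
proof -
  have "shortfall p = (LINT \<omega>|M. max 0 (X \<omega> - Q p) + Q p - X \<omega>)"
    unfolding shortfall_def survival_tail_eq[OF p] excess_def
    by (simp add: prob_space)
  also have "\<dots> = (LINT \<omega>|M. max 0 (Q p - X \<omega>))"
    by (intro Bochner_Integration.integral_cong) auto
  finally have eq: "shortfall p = (LINT \<omega>|M. max 0 (Q p - X \<omega>))" .
  show "0 \<le> shortfall p" unfolding eq by (rule integral_nonneg_AE) simp
  have "shortfall p \<le> (LINT \<omega>|M. Q p * indicator {\<omega>\<in>space M. X \<omega> \<le> Q p} \<omega>)"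
    unfolding eq
  proof (rule integral_mono_AE)
    show "AE \<omega> in M. max 0 (Q p - X \<omega>) \<le> Q p * indicator {\<omega>\<in>space M. X \<omega> \<le> Q p} \<omega>"
      using AE_nonneg AE_space by eventually_elim (auto simp: indicator_def)
  qed (auto intro!: integrable_max integrable_mult_right integrable_real_indicator simp: emeasure_eq_measure)
  also have "\<dots> = p * Q p"
    using F_Q[OF p] by (simp add: F_eq)
  finally show "shortfall p \<le> p * Q p" .
qed

lemma shortfall_tendsto_0: "(shortfall \<longlongrightarrow> 0) (at_right 0)"
proof (rule Lim_null_comparison)
  \<comment> \<open>Any fixed level would do in place of \<open>1 / 2\<close>; it serves to bound
    \<open>Q p\<close> for all small \<open>p\<close>.\<close>
  show "eventually (\<lambda>p. norm (shortfall p) \<le> p * Q (1 / 2)) (at_right 0)"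
  proof (rule eventually_at_rightI[of 0 "1 / 2"])
    fix p :: real assume p: "p \<in> {0<..<1 / 2}"
    have "p * Q p \<le> p * Q (1 / 2)"
      using p by (intro mult_left_mono Q_mono) auto
    then show "norm (shortfall p) \<le> p * Q (1 / 2)"
      using shortfall_bounds[of p] p by (auto intro: order_trans)
  qed simp
  show "((\<lambda>p. p * Q (1 / 2)) \<longlongrightarrow> 0) (at_right 0)"
    by (auto intro!: tendsto_eq_intros)
qed

section \<open>The survival tail as an integral over quantile levels\<close>

text \<open>As \<open>1 / f (Q q)\<close> need not be continuous in \<open>q\<close>, the fundamental theorem of calculus is
  applied to the Henstock-Kurzweil integral and transferred to the Lebesgue integral by
  nonnegativity.\<close>

lemma integral_tail:
  assumes p: "p \<in> {0<..<1}"
  shows "set_integrable lborel {p<..<1} (\<lambda>q. (1 - q) * (1 / f (Q q)))"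
    and "(LBINT q:{p<..<1}. (1 - q) * (1 / f (Q q))) = survival_tail M X u p"
proof -
  let ?h = "\<lambda>q. (1 - q) * (1 / f (Q q))"
  \<comment> \<open>Setting \<open>A 1 = 0\<close>, the limit of the tail, makes \<open>A\<close>
    continuous on \<open>{p..1}\<close>; the quantile at level 1 itself is not controlled.\<close>
  define A where "A q = (if q < 1 then - survival_tail M X u q else 0)" for q
  have lim: "(A \<longlongrightarrow> 0) (at_left 1)"
    by (rule Lim_transform_eventually[OF tendsto_minus[OF survival_tail_tendsto_0, simplified]])
      (auto simp: A_def eventually_at_filter)
  have DA: "(A has_real_derivative ?h q) (at q)" if "q \<in> {0<..<1}" for q
    by (rule has_field_derivative_transform_within_open[where S = "{0<..<1}"
          and f = "\<lambda>q. - survival_tail M X u q"])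
      (use that DERIV_survival_tail[of q] in \<open>auto intro!: derivative_eq_intros simp: A_def\<close>)
  have int: "(?h has_integral (A 1 - A p)) {p..1}"
  proof (rule fundamental_theorem_of_calculus_interior)
    show "continuous_on {p..1} A"
      unfolding continuous_on_eq_continuous_within
    proof
      fix q assume q: "q \<in> {p..1}"
      show "continuous (at q within {p..1}) A"
      proof (cases "q = 1")
        case True
        have "(A \<longlongrightarrow> A 1) (at 1 within {p..1})"
          using lim p by (simp add: A_def at_within_Icc_at_left)
        with True show ?thesis by (simp add: continuous_within)
      next
        case False
        then have "isCont A q"
          using p q by (intro DERIV_isCont[OF DA]) auto
        then show ?thesis by (rule continuous_at_imp_continuous_at_within)
      qed
    qed
  qed (use p DA in \<open>auto simp: has_real_derivative_iff_has_vector_derivative\<close>)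
  have "(?h has_integral survival_tail M X u p) {p..1}"
    using int p by (simp add: A_def)
  then have int': "(?h has_integral survival_tail M X u p) {p<..<1}"
    by (simp add: has_integral_Icc_iff_Ioo)
  have abs: "?h absolutely_integrable_on {p<..<1}"
    using int' p density_nonneg by (intro nonnegative_absolutely_integrable_1) auto
  \<comment> \<open>Monotonicity of \<open>Q\<close> is known only for levels strictly between 0 and
    1, hence the restricted space.\<close>
  have "Q \<in> borel_measurable (restrict_space borel {p<..<1})"
    using p by (intro borel_measurable_mono_on_fnc mono_onI Q_mono) auto
  from measurable_compose[OF this measurable_density]
  have [measurable]: "(\<lambda>q. f (Q q)) \<in> borel_measurable (restrict_space borel {p<..<1})" .
  have "(\<lambda>q. q) \<in> borel_measurable (restrict_space borel {p<..<1})"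
    by (intro measurable_restrict_space1) simp
  then have "?h \<in> borel_measurable (restrict_space borel {p<..<1})"
    by measurable
  then have meas: "(\<lambda>q. indicator {p<..<1} q *\<^sub>R ?h q) \<in> borel_measurable borel"
    by (subst (asm) borel_measurable_restrict_space_iff) auto
  \<comment> \<open>Absolute integrability refers to the completed measure; Borel measurability of
    the integrand brings it back to \<open>lborel\<close>.\<close>
  show 1: "set_integrable lborel {p<..<1} ?h"
    using abs meas unfolding set_integrable_def by (subst (asm) integrable_completion) auto
  show "(LBINT q:{p<..<1}. ?h q) = survival_tail M X u p"
    using set_borel_integral_eq_integral(2)[OF 1] int' by (simp add: integral_unique)
qed

end

section \<open>The characterisation of the dmrl order\<close>

theorem theorem2p10:
  fixes M :: "'a measure" and N :: "'b measure"
    and X :: "'a \<Rightarrow> real" and Y :: "'b \<Rightarrow> real"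
    and f g :: "real \<Rightarrow> real"
    and lX uX lY uY :: ereal
    and n :: nat and p :: "nat \<Rightarrow> real"
  defines "Finv \<equiv> quantile_fun M X" and "Ginv \<equiv> quantile_fun N Y"
  defines "r \<equiv> (\<lambda>t. f (Finv t) / g (Ginv t))"
  assumes X: "nonneg_rv_with_density M X f lX uX"
    and Y: "nonneg_rv_with_density N Y g lY uY"
    and n: "n \<ge> 1"
    and modes: "has_modes r n p"
  shows "dmrl_le M X uX N Y uY \<longleftrightarrow>
    (\<exists>m. n = 2 * m \<and>
       (\<forall>i\<in>{1..m}.
          (LBINT q=ereal (p (2 * i - 1))..1.
             (1 - q) * (1 / g (Ginv q) - r (p (2 * i - 1)) * (1 / f (Finv q)))) \<ge> 0))
    \<or>
    (\<exists>m. n = 2 * m + 1 \<and>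
       (\<forall>i\<in>{1..m}.
          (LBINT q=ereal (p (2 * i))..1.
             (1 - q) * (1 / g (Ginv q) - r (p (2 * i)) * (1 / f (Finv q)))) \<ge> 0) \<and>
       (\<exists>L::ereal.
          ((\<lambda>t. ereal (r t * (Finv t - (LINT \<omega>|M. X \<omega>)) - (Ginv t - (LINT \<omega>|N. Y \<omega>))))
             \<longlongrightarrow> L) (at_right 0) \<and> L \<ge> 0))"
proof -
  interpret X: rv_with_density M X f lX uX by standard (rule X)
  interpret Y: rv_with_density N Y g lY uY by standard (rule Y)
  define A where "A = survival_tail M X uX"
  define B where "B = survival_tail N Y uY"
  have f_pos: "0 < f (Finv t)" and g_pos: "0 < g (Ginv t)" if "t \<in> {0<..<1}" for t
    using X.density_Q_pos[OF that] Y.density_Q_pos[OF that] by (auto simp: Finv_def Ginv_def)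
  have r_pos: "0 < r t" if "t \<in> {0<..<1}" for t
    using f_pos[OF that] g_pos[OF that] by (simp add: r_def)
  \<comment> \<open>With \<open>c = 1 - t\<close> this gives \<open>B' = r A'\<close>, with
    \<open>c = t\<close> the same relation for the shortfalls.\<close>
  have r_mult: "r t * (c * (1 / f (Finv t))) = c * (1 / g (Ginv t))" if "t \<in> {0<..<1}" for c t
    using f_pos[OF that] by (simp add: r_def)
  interpret tail_pair "\<lambda>t. (1 - t) * (1 / f (Finv t))" r A B
  proof
    fix t :: real assume t: "t \<in> {0<..<1}"
    show "0 < (1 - t) * (1 / f (Finv t))"
      using f_pos[OF t] t by simp
    show "(A has_real_derivative - ((1 - t) * (1 / f (Finv t)))) (at t)"
      unfolding A_def Finv_def by (rule X.DERIV_survival_tail[OF t])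
    show "(B has_real_derivative - (r t * ((1 - t) * (1 / f (Finv t))))) (at t)"
      unfolding r_mult[OF t] unfolding B_def Ginv_def by (rule Y.DERIV_survival_tail[OF t])
  next
    show "(A \<longlongrightarrow> 0) (at_left 1)" unfolding A_def by (rule X.survival_tail_tendsto_0)
    show "(B \<longlongrightarrow> 0) (at_left 1)" unfolding B_def by (rule Y.survival_tail_tendsto_0)
  qed

  note p_range = has_modes_location[OF n modes]

  \<comment> \<open>\<open>r (p k)\<close> is constant under the integral, which is therefore the
    difference of \<open>B (p k)\<close> and \<open>r (p k) * A (p k)\<close>.\<close>
  have integral_eq: "(LBINT q=ereal (p k)..1.
      (1 - q) * (1 / g (Ginv q) - r (p k) * (1 / f (Finv q)))) = gap (p k)" if "k \<in> {1..n}" for k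
  proof -
    note k = p_range[OF that]
    have "(LBINT q=ereal (p k)..1. (1 - q) * (1 / g (Ginv q) - r (p k) * (1 / f (Finv q))))
      = (LBINT q:{p k<..<1}. (1 - q) * (1 / g (Ginv q)) - r (p k) * ((1 - q) * (1 / f (Finv q))))"
      using k by (simp add: interval_lebesgue_integral_le_eq one_ereal_def algebra_simps)
    also have "\<dots> = (LBINT q:{p k<..<1}. (1 - q) * (1 / g (Ginv q)))
        - (LBINT q:{p k<..<1}. r (p k) * ((1 - q) * (1 / f (Finv q))))"
      unfolding Finv_def Ginv_def
      by (rule set_integral_diff(2)[OF Y.integral_tail(1)[OF k] set_integrable_mult_right[OF X.integral_tail(1)[OF k]]])
    also have "\<dots> = gap (p k)"
      unfolding set_integral_mult_right unfolding Finv_def Ginv_def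
        X.integral_tail(2)[OF k] Y.integral_tail(2)[OF k] by (simp add: gap_def flip: A_def B_def)
    finally show ?thesis .
  qed

  have limit_iff: "(\<forall>t\<in>{0<..p 1}. 0 \<le> gap t) \<longleftrightarrow> (\<exists>L::ereal.
      ((\<lambda>t. ereal (r t * (Finv t - (LINT \<omega>|M. X \<omega>)) - (Ginv t - (LINT \<omega>|N. Y \<omega>))))
         \<longlongrightarrow> L) (at_right 0) \<and> L \<ge> 0)" if "odd n"
  proof -
    \<comment> \<open>Piece 0 is \<open>{0<..<p 1}\<close>, and \<open>n - 0\<close> is odd.\<close>
    have anti: "antimono_on {0<..<p 1} r"
      using modes that n by (auto simp: has_modes_def Let_def dest!: spec[of _ 0])
    have "(\<forall>t\<in>{0<..p 1}. 0 \<le> gap t) \<longleftrightarrow> (\<exists>L::ereal.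
      ((\<lambda>t. ereal (gap t + (r t * X.shortfall t - Y.shortfall t))) \<longlongrightarrow> L) (at_right 0) \<and> L \<ge> 0)"
    proof (rule gap_nonneg_near_0_iff[OF anti, where v = "\<lambda>t. t * (1 / f (Finv t))"])
      fix t :: real assume t: "t \<in> {0<..<1}"
      show "0 \<le> r t" using r_pos[OF t] by simp
      show "0 < t * (1 / f (Finv t))" using f_pos[OF t] t by simp
      show "(X.shortfall has_real_derivative t * (1 / f (Finv t))) (at t)"
        unfolding Finv_def by (rule X.DERIV_shortfall[OF t])
      show "(Y.shortfall has_real_derivative r t * (t * (1 / f (Finv t)))) (at t)"
        unfolding r_mult[OF t] unfolding Ginv_def by (rule Y.DERIV_shortfall[OF t])
      show "0 \<le> X.shortfall t" by (rule X.shortfall_bounds(1)[OF t])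
    qed (use p_range[of 1] n X.shortfall_tendsto_0 Y.shortfall_tendsto_0 in auto)
    \<comment> \<open>The shortfalls contain \<open>A\<close> and \<open>B\<close>, which cancel
      against those in \<open>gap\<close>.\<close>
    moreover have "gap t + (r t * X.shortfall t - Y.shortfall t)
        = r t * (Finv t - (LINT \<omega>|M. X \<omega>)) - (Ginv t - (LINT \<omega>|N. Y \<omega>))" for t
      by (simp add: gap_def X.shortfall_def Y.shortfall_def Finv_def Ginv_def algebra_simps
          flip: A_def B_def)
    ultimately show ?thesis by simp
  qed

  have dmrl: "dmrl_le M X uX N Y uY \<longleftrightarrow>
      (\<forall>k\<in>{1..n}. odd (n - k) \<longrightarrow> 0 \<le> gap (p k)) \<and> (odd n \<longrightarrow> (\<forall>t\<in>{0<..p 1}. 0 \<le> gap t))"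
    unfolding gap_nonneg_iff_at_modes[OF n modes, symmetric] mono_quotient_iff_gap_nonneg[symmetric]
    by (simp add: dmrl_le_def flip: A_def B_def)
  show ?thesis
  proof (cases "even n")
    case True
    then obtain m where m: "n = 2 * m" by blast
    \<comment> \<open>With \<open>n\<close> even, \<open>n - k\<close> is odd iff \<open>k\<close>
      is odd, which gives the indices of condition (a).\<close>
    have indices: "{k \<in> {1..n}. odd (n - k)} = (\<lambda>i. 2 * i - 1) ` {1..m}"
    proof (intro equalityI subsetI)
      fix k assume "k \<in> {k \<in> {1..n}. odd (n - k)}"
      then have "k \<in> {1..n}" "odd k" using m by auto
      moreover from \<open>odd k\<close> obtain j where "k = 2 * j + 1" by (elim oddE)
      ultimately show "k \<in> (\<lambda>i. 2 * i - 1) ` {1..m}"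
        using m by (intro image_eqI[of _ _ "j + 1"]) auto
    qed (use m in auto)
    have "(\<forall>k\<in>{1..n}. odd (n - k) \<longrightarrow> 0 \<le> gap (p k)) \<longleftrightarrow>
        (\<forall>k\<in>{k \<in> {1..n}. odd (n - k)}. 0 \<le> gap (p k))"
      by blast
    also have "\<dots> \<longleftrightarrow> (\<forall>i\<in>{1..m}. 0 \<le> gap (p (2 * i - 1)))"
      unfolding indices by blast
    finally have "(\<forall>k\<in>{1..n}. odd (n - k) \<longrightarrow> 0 \<le> gap (p k)) \<longleftrightarrow> (\<forall>i\<in>{1..m}. 0 \<le> gap (p (2 * i - 1)))" .
    moreover have "(LBINT q=ereal (p (2 * i - 1))..1.
        (1 - q) * (1 / g (Ginv q) - r (p (2 * i - 1)) * (1 / f (Finv q)))) = gap (p (2 * i - 1))"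
      if "i \<in> {1..m}" for i
      by (rule integral_eq) (use that m in auto)
    \<comment> \<open>\<open>n\<close> determines \<open>m\<close>, and its parity rules out the
      other alternative.\<close>
    moreover have "n = 2 * m' \<longleftrightarrow> m' = m" "n \<noteq> 2 * m' + 1" for m'
      using m by presburger+
    ultimately show ?thesis
      unfolding dmrl using True by simp
  next
    case False
    then obtain m where m: "n = 2 * m + 1" by (metis oddE)
    \<comment> \<open>With \<open>n\<close> odd, \<open>n - k\<close> is odd iff \<open>k\<close> is
      even, which gives the indices of condition (b).\<close>
    have indices: "{k \<in> {1..n}. odd (n - k)} = (\<lambda>i. 2 * i) ` {1..m}"
    proof (intro equalityI subsetI)
      fix k assume "k \<in> {k \<in> {1..n}. odd (n - k)}"
      then have "k \<in> {1..n}" "even k" using m by auto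
      then show "k \<in> (\<lambda>i. 2 * i) ` {1..m}"
        using m by (intro image_eqI[of _ _ "k div 2"]) auto
    qed (use m in auto)
    have "(\<forall>k\<in>{1..n}. odd (n - k) \<longrightarrow> 0 \<le> gap (p k)) \<longleftrightarrow>
        (\<forall>k\<in>{k \<in> {1..n}. odd (n - k)}. 0 \<le> gap (p k))"
      by blast
    also have "\<dots> \<longleftrightarrow> (\<forall>i\<in>{1..m}. 0 \<le> gap (p (2 * i)))"
      unfolding indices by blast
    finally have "(\<forall>k\<in>{1..n}. odd (n - k) \<longrightarrow> 0 \<le> gap (p k)) \<longleftrightarrow> (\<forall>i\<in>{1..m}. 0 \<le> gap (p (2 * i)))" .
    moreover have "(LBINT q=ereal (p (2 * i))..1.
        (1 - q) * (1 / g (Ginv q) - r (p (2 * i)) * (1 / f (Finv q)))) = gap (p (2 * i))"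
      if "i \<in> {1..m}" for i
      by (rule integral_eq) (use that m in auto)
    moreover have "n = 2 * m' + 1 \<longleftrightarrow> m' = m" "n \<noteq> 2 * m'" for m'
      using m by presburger+
    ultimately show ?thesis
      unfolding dmrl using False limit_iff[OF False] by simp
  qed
qed

end
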